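(* Let $n\ge 4$. For every $\alpha$ in the discrete spectrum $D_n$ and every irreducible $*$-representation $\pi\in\mathrm{Rep}\,\mathcal P_{n,\alpha}$, the system of $n$ subspaces $S_\pi$ is transitive; and the systems $S_\pi$ arising from inequivalent representations are nonisomorphic, i.e. if $\alpha,\alpha'\in D_n$ and $\pi\in\mathrm{Rep}\,\mathcal P_{n,\alpha}$, $\pi'\in\mathrm{Rep}\,\mathcal P_{n,\alpha'}$ are irreducible and not unitarily equivalent, then $S_\pi\not\cong S_{\pi'}$.
   Context: Hilbert spaces are complex and nonzero; $B(H)$ denotes the bounded linear operators on $H$. A system of $n$ subspaces $S=(H;H_1,\dots,H_n)$ consists of a Hilbert space $H$ and $n$ (closed) subspaces of it. Systems $S=(H;H_1,\dots,H_n)$ and $\tilde S=(\tilde H;\tilde H_1,\dots,\tilde H_n)$ are isomorphic, $S\cong\tilde S$, if there is a bounded linear bijection $R:H\to\tilde H$ with $R(H_i)=\tilde H_i$ for all $i$. Put $\mathrm{End}(S)=\{R\in B(H) : R(H_i)\subset H_i,\ i=1,\dots,n\}$; $S$ is transitive if $\mathrm{End}(S)=\mathbb C I_H$. For real $\alpha\ge 0$, $\mathcal P_{n,\alpha}=\mathbb C\langle p_1,\dots,p_n \mid p_1+\dots+p_n=\alpha e,\ p_j^2=p_j=p_j^*,\ j=1,\dots,n\rangle$ is a unital $*$-algebra with unit $e$. $\mathrm{Rep}\,\mathcal P_{n,\alpha}$ denotes its unital $*$-representations by bounded operators on Hilbert spaces; such a $\pi$ on $H$ is the same thing as orthogonal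 projections $P_i=\pi(p_i)$ on $H$ with $\sum_{i=1}^nP_i=\alpha I_H$. The associated system is $S_\pi=(H;P_1H,\dots,P_nH)$. The representation $\pi$ is irreducible if the only closed subspaces of $H$ invariant under all $P_i$ are $\{0\}$ and $H$. Representations $\pi$ on $H$ and $\pi'$ on $H'$ are unitarily equivalent if there is a unitary $W:H\to H'$ with $W\pi(p_i)=\pi'(p_i)W$ for all $i$ (this makes sense also for representations of $\mathcal P_{n,\alpha}$ and $\mathcal P_{n,\alpha'}$ with $\alpha\neq\alpha'$). Discrete spectrum: for $n\ge4$ let $$\Lambda_n^0=\Big\{0,\ 1+\tfrac1{n-1},\ 1+\tfrac1{(n-2)-\frac1{n-1}},\ \dots,\ 1+\tfrac{1}{(n-2)-\frac{1}{(n-2)-\frac{1}{\ddots-\frac1{n-1}}}},\dots\Big\},$$ $$\Lambda_n^1=\Big\{1,\ 1+\tfrac1{n-2},\ 1+\tfrac1{(n-2)-\frac1{n-2}},\ \dots,\ 1+\tfrac{1}{(n-2)-\frac{1}{(n-2)-\frac{1}{\ddots-\frac1{n-2}}}},\dots\Big\};$$ equivalently, $\Lambda_n^0$ and $\Lambda_n^1$ are the forward orbits of $0$ and of $1$, respectively, under the map $x\mapsto 1+\frac1{n-1-x}$. The discrete spectrum is $D_n=\Lambda_n^0\cup\Lambda_n^1\cup(n-\Lambda_n^1)\cup(n-\Lambda_n^0)$, where $n-\Lambda=\{n-x: x\in\Lambda\}$. *)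

theory Defs
  imports "HOL-Analysis.Analysis"
begin

section \<open>Complex Hilbert spaces\<close>

(* The complex inner product is linear in the first argument.  The type class real_inner
   supplies the real inner product Re (cinner x y), and with it positive definiteness and
   the norm.  Hilbert spaces are nonzero throughout. *)
class complex_hilbert_space = real_inner + complete_space +
  fixes scaleC :: "complex \<Rightarrow> 'a \<Rightarrow> 'a"  (infixr \<open>*\<^sub>C\<close> 75)
    and cinner :: "'a \<Rightarrow> 'a \<Rightarrow> complex"
  assumes scaleC_add_right: "c *\<^sub>C (x + y) = c *\<^sub>C x + c *\<^sub>C y"
    and scaleC_add_left: "(c + d) *\<^sub>C x = c *\<^sub>C x + d *\<^sub>C x"
    and scaleC_scaleC: "c *\<^sub>C (d *\<^sub>C x) = (c * d) *\<^sub>C x"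
    and scaleC_of_real: "complex_of_real r *\<^sub>C x = r *\<^sub>R x"
    and cinner_commute: "cinner x y = cnj (cinner y x)"
    and cinner_add_left: "cinner (x + y) z = cinner x z + cinner y z"
    and cinner_scaleC_left: "cinner (c *\<^sub>C x) y = c * cinner x y"
    and inner_eq_Re_cinner: "inner x y = Re (cinner x y)"
    and ex_nonzero: "\<exists>x. x \<noteq> 0"

lemma cinner_self: "cinner x x = complex_of_real ((norm x)\<^sup>2)"
proof -
  have "Im (cinner x x) = 0"
    using arg_cong[OF cinner_commute[of x x], of Im] by simp
  then show ?thesis
    by (simp add: complex_eq_iff power2_norm_eq_inner inner_eq_Re_cinner)
qed

instantiation complex :: complex_hilbert_space
begin

definition scaleC_complex :: "complex \<Rightarrow> complex \<Rightarrow> complex" where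
  "scaleC_complex c x = c * x"

definition cinner_complex :: "complex \<Rightarrow> complex \<Rightarrow> complex" where
  "cinner_complex x y = x * cnj y"

instance
proof
  show "\<exists>x::complex. x \<noteq> 0"
    by (rule exI[of _ 1]) simp
qed (simp_all add: scaleC_complex_def cinner_complex_def inner_complex_def
  algebra_simps scaleR_conv_of_real)

end

definition bounded_clinear ::
    "('a::complex_hilbert_space \<Rightarrow> 'b::complex_hilbert_space) \<Rightarrow> bool" where
  "bounded_clinear R \<longleftrightarrow> bounded_linear R \<and> (\<forall>c x. R (c *\<^sub>C x) = c *\<^sub>C R x)"

definition closed_csubspace :: "'a::complex_hilbert_space set \<Rightarrow> bool" where
  "closed_csubspace V \<longleftrightarrow> closed V \<and> 0 \<in> V \<and>
     (\<forall>x\<in>V. \<forall>y\<in>V. x + y \<in> V) \<and> (\<forall>c. \<forall>x\<in>V. c *\<^sub>C x \<in> V)"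

definition orthogonal_projection ::
    "('a::complex_hilbert_space \<Rightarrow> 'a) \<Rightarrow> bool" where
  "orthogonal_projection P \<longleftrightarrow> bounded_clinear P \<and>
     (\<forall>x. P (P x) = P x) \<and> (\<forall>x y. cinner (P x) y = cinner x (P y))"

definition unitary_map ::
    "('a::complex_hilbert_space \<Rightarrow> 'b::complex_hilbert_space) \<Rightarrow> bool" where
  "unitary_map W \<longleftrightarrow> bounded_clinear W \<and> bij W \<and>
     (\<forall>x y. cinner (W x) (W y) = cinner x y)"

section \<open>Systems of subspaces\<close>

(* A system of n subspaces is a family of subsets of the ambient type; only the values at
   the indices 1, ..., n are relevant. *)
definition subspace_system :: "nat \<Rightarrow> (nat \<Rightarrow> 'a::complex_hilbert_space set) \<Rightarrow> bool" where
  "subspace_system n S \<longleftrightarrow> (\<forall>i\<in>{1..n}. closed_csubspace (S i))"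

definition isomorphic_systems ::
    "nat \<Rightarrow> (nat \<Rightarrow> 'a::complex_hilbert_space set) \<Rightarrow>
      (nat \<Rightarrow> 'b::complex_hilbert_space set) \<Rightarrow> bool" where
  "isomorphic_systems n S S' \<longleftrightarrow>
     (\<exists>R. bounded_clinear R \<and> bij R \<and> (\<forall>i\<in>{1..n}. R ` S i = S' i))"

definition End_system ::
    "nat \<Rightarrow> (nat \<Rightarrow> 'a::complex_hilbert_space set) \<Rightarrow> ('a \<Rightarrow> 'a) set" where
  "End_system n S = {R. bounded_clinear R \<and> (\<forall>i\<in>{1..n}. R ` S i \<subseteq> S i)}"

definition transitive_system ::
    "nat \<Rightarrow> (nat \<Rightarrow> 'a::complex_hilbert_space set) \<Rightarrow> bool" where
  "transitive_system n S \<longleftrightarrow> End_system n S = {R. \<exists>c. R = (\<lambda>x. c *\<^sub>C x)}"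

section \<open>Representations\<close>

(* A unital *-representation of
     C<p_1, ..., p_n | p_1 + ... + p_n = alpha e, p_j^2 = p_j = p_j^*>
   is given by the images P i of the generators. *)
definition is_rep ::
    "nat \<Rightarrow> real \<Rightarrow> (nat \<Rightarrow> 'a::complex_hilbert_space \<Rightarrow> 'a) \<Rightarrow> bool" where
  "is_rep n \<alpha> P \<longleftrightarrow> (\<forall>i\<in>{1..n}. orthogonal_projection (P i)) \<and>
     (\<forall>x. (\<Sum>i=1..n. P i x) = complex_of_real \<alpha> *\<^sub>C x)"

definition irreducible_rep ::
    "nat \<Rightarrow> (nat \<Rightarrow> 'a::complex_hilbert_space \<Rightarrow> 'a) \<Rightarrow> bool" where
  "irreducible_rep n P \<longleftrightarrow>
     (\<forall>V. closed_csubspace V \<and> (\<forall>i\<in>{1..n}. P i ` V \<subseteq> V) \<longrightarrow> V = {0} \<or> V = UNIV)"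

definition unitarily_equivalent ::
    "nat \<Rightarrow> (nat \<Rightarrow> 'a::complex_hilbert_space \<Rightarrow> 'a) \<Rightarrow>
      (nat \<Rightarrow> 'b::complex_hilbert_space \<Rightarrow> 'b) \<Rightarrow> bool" where
  "unitarily_equivalent n P P' \<longleftrightarrow>
     (\<exists>W. unitary_map W \<and> (\<forall>i\<in>{1..n}. \<forall>x. W (P i x) = P' i (W x)))"

definition rep_system ::
    "(nat \<Rightarrow> 'a::complex_hilbert_space \<Rightarrow> 'a) \<Rightarrow> nat \<Rightarrow> 'a set" where
  "rep_system P i = range (P i)"

lemma closed_csubspace_range_projection:
  assumes "orthogonal_projection P"
  shows "closed_csubspace (range P)"
proof -
  have bl: "bounded_linear P" and sc: "\<And>c x. P (c *\<^sub>C x) = c *\<^sub>C P x"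
    and idem: "\<And>x. P (P x) = P x"
    using assms by (auto simp: orthogonal_projection_def bounded_clinear_def)
  interpret bounded_linear P by (rule bl)
  have eq: "range P = {x. P x = x}"
  proof
    show "range P \<subseteq> {x. P x = x}"
      using idem by blast
    show "{x. P x = x} \<subseteq> range P"
      by (metis (mono_tags, lifting) mem_Collect_eq rangeI subsetI)
  qed
  have "closed {x. P x = x}"
    by (intro closed_Collect_eq continuous_on continuous_on_id)
  then show ?thesis
    unfolding closed_csubspace_def eq by (auto simp: zero add sc)
qed

lemma subspace_system_rep_system:
  assumes "is_rep n \<alpha> P"
  shows "subspace_system n (rep_system P)"
  using assms closed_csubspace_range_projection
  by (auto simp: subspace_system_def rep_system_def is_rep_def)

section \<open>The discrete spectrum\<close>

definition spectrum_map :: "nat \<Rightarrow> real \<Rightarrow> real" where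
  "spectrum_map n x = 1 + 1 / (real n - 1 - x)"

definition Lambda0 :: "nat \<Rightarrow> real set" where
  "Lambda0 n = range (\<lambda>k. (spectrum_map n ^^ k) 0)"

definition Lambda1 :: "nat \<Rightarrow> real set" where
  "Lambda1 n = range (\<lambda>k. (spectrum_map n ^^ k) 1)"

definition discrete_spectrum :: "nat \<Rightarrow> real set" where
  "discrete_spectrum n = Lambda0 n \<union> Lambda1 n \<union>
     (\<lambda>x. real n - x) ` Lambda1 n \<union> (\<lambda>x. real n - x) ` Lambda0 n"

end

theory Submission
  imports
    Defs
    "HOL-Library.Function_Algebras"
    "HOL-Computational_Algebra.Fundamental_Theorem_Algebra"
begin

text \<open>
  The heart of the matter is a trace computation.  Let \<open>\<Sum>P\<^sub>i = \<alpha>\<close> on \<open>H\<close>, \<open>\<Sum>P'\<^sub>i = \<alpha>'\<close> on \<open>H'\<close>, and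
  let \<open>R : H \<rightarrow> H'\<close> map \<open>P\<^sub>iH\<close> into \<open>P'\<^sub>iH'\<close>, that is, \<open>P'\<^sub>iRP\<^sub>i = RP\<^sub>i\<close>.  If \<open>H\<close> is finite-dimensional,
  then Pythagoras in the Hilbert-Schmidt norm and \<open>tr(P\<^sub>iR\<^sup>*RP\<^sub>i) = tr(R\<^sup>*RP\<^sub>i)\<close> give
  \<open>\<Sum>\<^sub>i \<parallel>P'\<^sub>iR(1 - P\<^sub>i)\<parallel>\<^sup>2 = (\<alpha>' - \<alpha>) \<parallel>R\<parallel>\<^sup>2\<close> (\<open>morphism_defect\<close>).  Hence a nonzero \<open>R\<close> forces \<open>\<alpha> \<le> \<alpha>'\<close>, and
  for \<open>\<alpha> = \<alpha>'\<close> every such \<open>R\<close> intertwines the projections themselves (\<open>morphism_intertwines\<close>).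
  With \<open>P' = P\<close>, Schur's lemma makes \<open>R\<close> a scalar: this is transitivity.  For an isomorphism \<open>R\<close> of
  systems, applying the inequality to \<open>R\<close> and to its inverse gives \<open>\<alpha> = \<alpha>'\<close>; then \<open>R\<^sup>*R\<close> commutes
  with every \<open>P\<^sub>i\<close>, so it is a positive scalar, and \<open>R\<close> is a multiple of a unitary equivalence.

  The hypothesis \<open>\<alpha> \<in> D\<^sub>n\<close> serves to make irreducible representations finite-dimensional
  (\<open>irreducible_rep_finite_span\<close>).  Call a system of projections locally finite if every vector
  lies in a finite-dimensional invariant subspace.  For \<open>\<alpha> = 0\<close> all \<open>P\<^sub>i\<close> vanish and for \<open>\<alpha> = 1\<close> they
  are mutually orthogonal, so both parameters force local finiteness.  Two constructions reach the
  other parameters: complementation \<open>P\<^sub>i \<mapsto> 1 - P\<^sub>i\<close> replaces \<open>\<alpha>\<close> by \<open>n - \<alpha>\<close>, and the passage to the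
  space of tuples \<open>(x\<^sub>1, ..., x\<^sub>n)\<close> with \<open>x\<^sub>i \<in> P\<^sub>iH\<close> and \<open>\<Sum>x\<^sub>i = 0\<close>, with suitable projections, replaces \<open>\<alpha>\<close> by
  \<open>\<alpha>/(\<alpha> - 1)\<close>.  Local finiteness descends from the new system to the old one in both cases
  (\<open>locally_finite_complement\<close>, \<open>locally_finite_dual\<close>).  As the second construction followed by
  the first turns the parameter \<open>1 + 1/(n - 1 - x)\<close> into \<open>x\<close>, induction along the orbits of \<open>0\<close> and \<open>1\<close>
  covers the discrete spectrum.  Both constructions are algebraic and stay within real pre-Hilbert
  spaces.
\<close>

section \<open>Systems of projections on pre-Hilbert spaces\<close>

text \<open>
  The space of tuples is a new space at each step of the induction, whereas an induction needs a
  statement about one type.  The type \<open>nat list \<Rightarrow> 'a\<close> contains countably many independent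
  copies of itself, hence the tuples formed from any of its subspaces; this is why functions are
  made a real vector space here.
\<close>

instantiation "fun" :: (type, real_vector) real_vector
begin

definition scaleR_fun :: "real \<Rightarrow> ('a \<Rightarrow> 'b) \<Rightarrow> 'a \<Rightarrow> 'b" where
  "scaleR_fun r f = (\<lambda>x. r *\<^sub>R f x)"

instance
  by standard (auto simp: scaleR_fun_def fun_eq_iff scaleR_add_right scaleR_add_left)

end

lemma scaleR_fun_apply [simp]: "(r *\<^sub>R f) x = r *\<^sub>R f x"
  by (simp add: scaleR_fun_def)

text \<open>
  A family of orthogonal projections with sum \<open>\<alpha>\<close> on the pre-Hilbert space \<open>(X, B)\<close>.  Bilinearity of \<open>B\<close>
  and linearity of the \<open>P\<^sub>i\<close> are required on the whole type, where they survive the constructions below;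
  the geometric properties, which concern \<open>X\<close> only, are relativised.
\<close>
locale projection_system =
  fixes n :: nat and \<alpha> :: real and X :: "'v::real_vector set"
    and B :: "'v \<Rightarrow> 'v \<Rightarrow> real" and P :: "nat \<Rightarrow> 'v \<Rightarrow> 'v"
  assumes subspace_X: "subspace X"
    and bilinear_B: "bilinear B"
    and B_commute: "B x y = B y x"
    and B_nonneg: "B x x \<ge> 0"
    and B_definite: "x \<in> X \<Longrightarrow> B x x = 0 \<Longrightarrow> x = 0"
    and linear_P: "i \<in> {1..n} \<Longrightarrow> linear (P i)"
    and P_closed: "i \<in> {1..n} \<Longrightarrow> x \<in> X \<Longrightarrow> P i x \<in> X"
    and P_idem: "i \<in> {1..n} \<Longrightarrow> x \<in> X \<Longrightarrow> P i (P i x) = P i x"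
    and P_symmetric: "i \<in> {1..n} \<Longrightarrow> x \<in> X \<Longrightarrow> y \<in> X \<Longrightarrow> B (P i x) y = B x (P i y)"
    and P_sum: "x \<in> X \<Longrightarrow> (\<Sum>i=1..n. P i x) = \<alpha> *\<^sub>R x"
begin

lemma B_sum_left: "B (\<Sum>i\<in>I. f i) y = (\<Sum>i\<in>I. B (f i) y)"
proof -
  have "linear (\<lambda>x. B x y)"
    using bilinear_B by (simp add: bilinear_def)
  then show ?thesis
    by (rule linear_sum)
qed

lemma sum_B_P:
  assumes "x \<in> X"
  shows "(\<Sum>i=1..n. B (P i x) (P i x)) = \<alpha> * B x x"
proof -
  have "(\<Sum>i=1..n. B (P i x) (P i x)) = (\<Sum>i=1..n. B (P i x) x)"
    using assms by (intro sum.cong refl) (metis B_commute P_closed P_idem P_symmetric)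
  also have "\<dots> = B (\<alpha> *\<^sub>R x) x"
    by (simp only: B_sum_left[symmetric] P_sum[OF assms])
  finally show ?thesis
    using bilinear_lmul[OF bilinear_B] by simp
qed

end

definition locally_finite :: "nat \<Rightarrow> 'v::real_vector set \<Rightarrow> (nat \<Rightarrow> 'v \<Rightarrow> 'v) \<Rightarrow> bool" where
  "locally_finite n X P \<longleftrightarrow>
     (\<forall>x\<in>X. \<exists>F. finite F \<and> F \<subseteq> X \<and> x \<in> span F \<and> (\<forall>i\<in>{1..n}. \<forall>y\<in>F. P i y \<in> span F))"

text \<open>
  From \<open>\<Sum> \<parallel>P\<^sub>i x\<parallel>\<^sup>2 = \<alpha> \<parallel>x\<parallel>\<^sup>2\<close> all \<open>P\<^sub>i x\<close> vanish when \<open>\<alpha> = 0\<close>, and \<open>{x}\<close> spans an invariant subspace.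
\<close>
lemma (in projection_system) locally_finite_zero:
  assumes "\<alpha> = 0"
  shows "locally_finite n X P"
  unfolding locally_finite_def
proof
  fix x assume x: "x \<in> X"
  have "P i x = 0" if "i \<in> {1..n}" for i
  proof -
    have "(\<Sum>i=1..n. B (P i x) (P i x)) = 0"
      using sum_B_P[OF x] assms by simp
    then have "B (P i x) (P i x) = 0"
      using that by (subst (asm) sum_nonneg_eq_0_iff) (auto simp: B_nonneg)
    then show ?thesis
      using B_definite P_closed that x by blast
  qed
  then show "\<exists>F. finite F \<and> F \<subseteq> X \<and> x \<in> span F \<and> (\<forall>i\<in>{1..n}. \<forall>y\<in>F. P i y \<in> span F)"
    using x by (intro exI[of _ "{x}"]) (auto simp: span_base span_zero)
qed

text \<open>
  The same identity for the vector \<open>P\<^sub>i x\<close>, in whose sum the term of index \<open>i\<close> already exhausts the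
  right-hand side, gives \<open>P\<^sub>j P\<^sub>i x = 0\<close> for \<open>j \<noteq> i\<close>.  So the \<open>P\<^sub>i x\<close> span an invariant subspace, and \<open>x\<close> is
  their sum.
\<close>
lemma (in projection_system) locally_finite_one:
  assumes "\<alpha> = 1"
  shows "locally_finite n X P"
  unfolding locally_finite_def
proof
  fix x assume x: "x \<in> X"
  have orth: "P j (P i x) = 0" if i: "i \<in> {1..n}" and j: "j \<in> {1..n}" and ne: "j \<noteq> i" for i j
  proof -
    have Pix: "P i x \<in> X"
      using P_closed i x by blast
    let ?q = "\<lambda>j. B (P j (P i x)) (P j (P i x))"
    have "?q i + (\<Sum>j\<in>{1..n} - {i}. ?q j) = (\<Sum>j=1..n. ?q j)"
      using i by (subst sum.remove[of "{1..n}" i]) auto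
    also have "\<dots> = ?q i"
      using sum_B_P[OF Pix] assms P_idem[OF i x] by simp
    finally have "?q i + (\<Sum>j\<in>{1..n} - {i}. ?q j) = ?q i" .
    then have "(\<Sum>j\<in>{1..n} - {i}. ?q j) = 0"
      by simp
    then have "?q j = 0"
      using j ne by (subst (asm) sum_nonneg_eq_0_iff) (auto simp: B_nonneg)
    then show ?thesis
      using B_definite P_closed j Pix by blast
  qed
  let ?F = "(\<lambda>i. P i x) ` {1..n}"
  have "x = (\<Sum>i=1..n. P i x)"
    using P_sum[OF x] assms by simp
  also have "\<dots> \<in> span ?F"
    by (intro span_sum span_base) auto
  finally have xF: "x \<in> span ?F" .
  have inv: "P j (P i x) \<in> span ?F" if "i \<in> {1..n}" "j \<in> {1..n}" for i j
  proof (cases "j = i")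
    case True
    then have "P j (P i x) = P i x"
      using P_idem that x by auto
    then show ?thesis
      using that by (auto intro: span_base)
  next
    case False
    then show ?thesis
      using orth that by (simp add: span_zero)
  qed
  show "\<exists>F. finite F \<and> F \<subseteq> X \<and> x \<in> span F \<and> (\<forall>i\<in>{1..n}. \<forall>y\<in>F. P i y \<in> span F)"
    using xF inv x P_closed by (intro exI[of _ ?F]) auto
qed

section \<open>The reflection functors\<close>

lemma (in projection_system) complement_system:
  "projection_system n (real n - \<alpha>) X B (\<lambda>i x. x - P i x)"
proof (rule projection_system.intro)
  show "(\<Sum>i=1..n. x - P i x) = (real n - \<alpha>) *\<^sub>R x" if "x \<in> X" for x
    using P_sum[OF that] by (simp add: sum_subtractf scaleR_left_diff_distrib sum_constant_scaleR)
  show "B (x - P i x) y = B x (y - P i y)" if "i \<in> {1..n}" "x \<in> X" "y \<in> X" for i x y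
    using P_symmetric[OF that] by (simp add: bilinear_lsub[OF bilinear_B] bilinear_rsub[OF bilinear_B])
  show "x - P i x - P i (x - P i x) = x - P i x" if "i \<in> {1..n}" "x \<in> X" for i x
    using P_idem[OF that] linear_P[OF that(1)] by (simp add: linear_diff)
  show "linear (\<lambda>x. x - P i x)" if "i \<in> {1..n}" for i
    using linear_P[OF that] by (intro linear_compose_sub linear_ident)
qed (use subspace_X bilinear_B B_commute B_nonneg B_definite P_closed in
    \<open>auto intro: subspace_diff\<close>)

lemma locally_finite_complement:
  assumes "locally_finite n X (\<lambda>i x. x - P i x)"
  shows "locally_finite n X P"
proof -
  have "P i y \<in> span F" if "y \<in> F" "y - P i y \<in> span F" for F i y
    using span_diff[OF span_base[OF that(1)] that(2)] by simp
  then show ?thesis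
    using assms unfolding locally_finite_def by metis
qed

text \<open>
  The copies of \<open>nat list \<Rightarrow> 'a\<close> inside itself: copy \<open>i\<close> consists of the functions supported on lists
  with head \<open>i\<close>.  A function vanishing at the empty list is thereby a tuple of functions.
\<close>
definition coord :: "nat \<Rightarrow> (nat list \<Rightarrow> 'a) \<Rightarrow> nat list \<Rightarrow> 'a" where
  "coord i x = (\<lambda>l. x (i # l))"

definition inject :: "nat \<Rightarrow> (nat list \<Rightarrow> 'a::zero) \<Rightarrow> nat list \<Rightarrow> 'a" where
  "inject i x = (\<lambda>l. case l of [] \<Rightarrow> 0 | j # m \<Rightarrow> if j = i then x m else 0)"

lemma coord_inject: "coord i (inject j x) = (if i = j then x else 0)"
  by (auto simp: coord_def inject_def fun_eq_iff)

lemma linear_coord: "linear (coord i :: (nat list \<Rightarrow> 'a::real_vector) \<Rightarrow> _)"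
  by (rule linearI) (auto simp: coord_def fun_eq_iff)

lemma linear_inject: "linear (inject i :: (nat list \<Rightarrow> 'a::real_vector) \<Rightarrow> _)"
  by (rule linearI) (auto simp: inject_def fun_eq_iff split: list.splits)

locale list_projection_system = projection_system n \<alpha> X B P
  for n \<alpha> and X :: "(nat list \<Rightarrow> 'a::real_vector) set" and B P
begin

text \<open>The first condition says that \<open>x\<close> is a tuple with index set \<open>{1..n}\<close>.\<close>
definition dual_space :: "(nat list \<Rightarrow> 'a) set" where
  "dual_space = {x. x = (\<Sum>i=1..n. inject i (coord i x)) \<and>
     (\<forall>i\<in>{1..n}. coord i x \<in> X \<and> P i (coord i x) = coord i x) \<and>
     (\<Sum>i=1..n. coord i x) = 0}"

definition dual_form :: "(nat list \<Rightarrow> 'a) \<Rightarrow> (nat list \<Rightarrow> 'a) \<Rightarrow> real" where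
  "dual_form x y = (\<Sum>i=1..n. B (coord i x) (coord i y))"

text \<open>
  The orthogonal projection onto \<open>dual_space\<close>, within the direct sum of the \<open>P\<^sub>i X\<close>, of the tuple whose
  only nonzero entry is \<open>h\<close>, at position \<open>i\<close>.  On \<open>P\<^sub>i X\<close> it is an isometry up to the factor
  \<open>1 - 1/\<alpha>\<close> in squared norm, whence the factor \<open>\<alpha>/(\<alpha> - 1)\<close> in the definition of the
  dual projections.
\<close>
definition dual_inclusion :: "nat \<Rightarrow> (nat list \<Rightarrow> 'a) \<Rightarrow> nat list \<Rightarrow> 'a" where
  "dual_inclusion i h = inject i h - (1 / \<alpha>) *\<^sub>R (\<Sum>j=1..n. inject j (P j h))"

definition dual_projection :: "nat \<Rightarrow> (nat list \<Rightarrow> 'a) \<Rightarrow> nat list \<Rightarrow> 'a" where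
  "dual_projection i x = (\<alpha> / (\<alpha> - 1)) *\<^sub>R dual_inclusion i (coord i x)"

lemma coord_dual_inclusion:
  assumes "j \<in> {1..n}"
  shows "coord j (dual_inclusion i h) = (if j = i then h else 0) - (1 / \<alpha>) *\<^sub>R P j h"
proof -
  have "(\<Sum>k=1..n. coord j (inject k (P k h))) = P j h"
    using assms by (simp add: coord_inject)
  then show ?thesis
    by (simp add: dual_inclusion_def linear_diff[OF linear_coord] linear_scale[OF linear_coord]
        linear_sum[OF linear_coord] coord_inject)
qed

lemma linear_dual_inclusion: "linear (dual_inclusion i)"
proof -
  have "linear (\<lambda>h. inject j (P j h))" if "j \<in> {1..n}" for j
    using linear_compose[OF linear_P[OF that] linear_inject[of j]] by (simp add: o_def)
  then have "linear (\<lambda>h. (1 / \<alpha>) *\<^sub>R (\<Sum>j=1..n. inject j (P j h)))"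
    by (intro linear_compose_scale_right linear_compose_sum) auto
  then show ?thesis
    unfolding dual_inclusion_def by (intro linear_compose_sub linear_inject)
qed

lemma sum_inject_coord_dual_inclusion:
  assumes "i \<in> {1..n}"
  shows "(\<Sum>j=1..n. inject j (coord j (dual_inclusion i h))) = dual_inclusion i h"
proof -
  have "(\<Sum>j=1..n. inject j (coord j (dual_inclusion i h))) =
      (\<Sum>j=1..n. (if j = i then inject i h else 0) - (1 / \<alpha>) *\<^sub>R inject j (P j h))"
    by (intro sum.cong refl) (simp add: coord_dual_inclusion linear_diff[OF linear_inject]
        linear_scale[OF linear_inject] linear_0[OF linear_inject] linear_neg[OF linear_inject])
  also have "\<dots> = (\<Sum>j=1..n. if j = i then inject i h else 0)
      - (1 / \<alpha>) *\<^sub>R (\<Sum>j=1..n. inject j (P j h))"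
    by (simp only: sum_subtractf scaleR_sum_right)
  also have "\<dots> = dual_inclusion i h"
    using assms by (simp add: dual_inclusion_def)
  finally show ?thesis .
qed

lemma dual_inclusion_in_dual_space:
  assumes "\<alpha> \<noteq> 0" and i: "i \<in> {1..n}" and h: "h \<in> X" "P i h = h"
  shows "dual_inclusion i h \<in> dual_space"
proof -
  have "(\<Sum>j=1..n. coord j (dual_inclusion i h)) =
      (\<Sum>j=1..n. if j = i then h else 0) - (1 / \<alpha>) *\<^sub>R (\<Sum>j=1..n. P j h)"
    by (simp add: coord_dual_inclusion sum_subtractf scaleR_sum_right)
  also have "\<dots> = 0"
    using assms P_sum[OF h(1)] by simp
  finally have "(\<Sum>j=1..n. coord j (dual_inclusion i h)) = 0" .
  moreover have "coord j (dual_inclusion i h) \<in> X \<and> P j (coord j (dual_inclusion i h)) = coord j (dual_inclusion i h)"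
    if j: "j \<in> {1..n}" for j
    using h P_closed[OF j h(1)] P_idem[OF j h(1)] subspace_X
    by (auto simp: coord_dual_inclusion[OF j] linear_diff[OF linear_P[OF j]] linear_neg[OF linear_P[OF j]]
        linear_scale[OF linear_P[OF j]] linear_0[OF linear_P[OF j]] subspace_diff subspace_scale subspace_neg)
  ultimately show ?thesis
    using sum_inject_coord_dual_inclusion[OF i] by (simp add: dual_space_def)
qed

text \<open>
  The right-hand side is symmetric in \<open>x\<close> and \<open>y\<close>: this is why the dual projections are self-adjoint.
  The cross terms \<open>B (P\<^sub>j x\<^sub>i) y\<^sub>j = B x\<^sub>i y\<^sub>j\<close> cancel because the entries of \<open>y\<close> sum to zero.
\<close>
lemma dual_form_projection:
  assumes "\<alpha> \<noteq> 0" and i: "i \<in> {1..n}" and x: "x \<in> dual_space" and y: "y \<in> dual_space"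
  shows "dual_form (dual_projection i x) y = \<alpha> / (\<alpha> - 1) * B (coord i x) (coord i y)"
proof -
  have cx: "coord i x \<in> X"
    using x i by (auto simp: dual_space_def)
  have cy: "coord j y \<in> X" "P j (coord j y) = coord j y" if "j \<in> {1..n}" for j
    using y that by (auto simp: dual_space_def)
  have *: "B (P j (coord i x)) (coord j y) = B (coord i x) (coord j y)" if "j \<in> {1..n}" for j
    using P_symmetric[OF that cx] cy that by simp
  have "(\<Sum>j=1..n. B (coord i x) (coord j y)) = B (coord i x) (\<Sum>j=1..n. coord j y)"
    by (subst (1 2) B_commute) (simp add: B_sum_left)
  also have "\<dots> = 0"
    using y by (simp add: dual_space_def bilinear_rzero[OF bilinear_B])
  finally have zero: "(\<Sum>j=1..n. B (coord i x) (coord j y)) = 0" .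
  have "dual_form (dual_projection i x) y = \<alpha> / (\<alpha> - 1) *
      (\<Sum>j=1..n. (if j = i then B (coord i x) (coord i y) else 0) - 1 / \<alpha> * B (coord i x) (coord j y))"
    unfolding dual_form_def sum_distrib_left
  proof (intro sum.cong refl)
    fix j assume j: "j \<in> {1..n}"
    show "B (coord j (dual_projection i x)) (coord j y) = \<alpha> / (\<alpha> - 1) *
        ((if j = i then B (coord i x) (coord i y) else 0) - 1 / \<alpha> * B (coord i x) (coord j y))"
      using *[OF j]
      by (auto simp: dual_projection_def linear_scale[OF linear_coord] coord_dual_inclusion[OF j]
          bilinear_lsub[OF bilinear_B] bilinear_lmul[OF bilinear_B] bilinear_lneg[OF bilinear_B]
          bilinear_lzero[OF bilinear_B])
  qed
  also have "\<dots> = \<alpha> / (\<alpha> - 1) * B (coord i x) (coord i y)"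
    using i by (simp only: sum_subtractf sum_distrib_left[symmetric] zero) simp
  finally show ?thesis .
qed

text \<open>
  The factor \<open>\<alpha>/(\<alpha> - 1)\<close> makes the dual projections idempotent, because entry \<open>i\<close> of the \<open>i\<close>-th
  inclusion of \<open>h \<in> P\<^sub>i X\<close> is \<open>(1 - 1/\<alpha>) h\<close>.  It is also their sum, because the inclusions of the
  entries of \<open>x\<close> add up to \<open>x\<close>: their common correction terms \<open>P\<^sub>j x\<^sub>i\<close> cancel on summing over \<open>i\<close>.
\<close>
lemma dual_system:
  assumes "\<alpha> \<noteq> 0" "\<alpha> \<noteq> 1"
  shows "list_projection_system n (\<alpha> / (\<alpha> - 1)) dual_space dual_form dual_projection"
proof (intro list_projection_system.intro projection_system.intro)
  show "subspace dual_space"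
    unfolding dual_space_def subspace_def
    using subspace_X
    by (auto simp: linear_0[OF linear_coord] linear_add[OF linear_coord] linear_scale[OF linear_coord]
        linear_0[OF linear_inject] linear_add[OF linear_inject] linear_scale[OF linear_inject]
        linear_0[OF linear_P] linear_add[OF linear_P] linear_scale[OF linear_P]
        sum.distrib scaleR_sum_right[symmetric] subspace_0 subspace_add subspace_scale)
  show "bilinear dual_form"
    unfolding dual_form_def bilinear_def
    by (auto intro!: linear_compose_sum linearI simp: linear_add[OF linear_coord]
        linear_scale[OF linear_coord] bilinear_ladd[OF bilinear_B] bilinear_radd[OF bilinear_B]
        bilinear_lmul[OF bilinear_B] bilinear_rmul[OF bilinear_B])
  show "dual_form x y = dual_form y x" for x y
    by (simp add: dual_form_def B_commute)
  show "dual_form x x \<ge> 0" for x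
    by (simp add: dual_form_def B_nonneg sum_nonneg)
  show "x = 0" if x: "x \<in> dual_space" and z: "dual_form x x = 0" for x
  proof -
    have "coord i x = 0" if "i \<in> {1..n}" for i
    proof -
      have "B (coord i x) (coord i x) = 0"
        using z that unfolding dual_form_def
        by (subst (asm) sum_nonneg_eq_0_iff) (auto simp: B_nonneg)
      then show ?thesis
        using x that B_definite by (auto simp: dual_space_def)
    qed
    then have "(\<Sum>i=1..n. inject i (coord i x)) = 0"
      by (simp add: linear_0[OF linear_inject])
    then show ?thesis
      using x by (simp add: dual_space_def)
  qed
  show "linear (dual_projection i)" if "i \<in> {1..n}" for i
    unfolding dual_projection_def
    using linear_compose[OF linear_coord linear_dual_inclusion]
    by (intro linear_compose_scale_right) (simp add: o_def)
  show *: "dual_projection i x \<in> dual_space" if "i \<in> {1..n}" "x \<in> dual_space" for i x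
    unfolding dual_projection_def
  proof (rule subspace_scale[OF \<open>subspace dual_space\<close>], rule dual_inclusion_in_dual_space)
    show "coord i x \<in> X" "P i (coord i x) = coord i x"
      using that by (auto simp: dual_space_def)
  qed (use assms that in auto)
  show "dual_projection i (dual_projection i x) = dual_projection i x"
    if i: "i \<in> {1..n}" and x: "x \<in> dual_space" for i x
  proof -
    have "P i (coord i x) = coord i x"
      using that by (auto simp: dual_space_def)
    then have "coord i (dual_projection i x) = (\<alpha> / (\<alpha> - 1) * (1 - 1 / \<alpha>)) *\<^sub>R coord i x"
      by (simp add: dual_projection_def linear_scale[OF linear_coord] coord_dual_inclusion[OF i]
          scaleR_right_diff_distrib scaleR_left_diff_distrib right_diff_distrib)
    also have "\<alpha> / (\<alpha> - 1) * (1 - 1 / \<alpha>) = 1"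
      using assms by (simp add: field_simps)
    finally have "coord i (dual_projection i x) = coord i x"
      by simp
    then show ?thesis
      by (simp only: dual_projection_def[of i])
  qed
  show "dual_form (dual_projection i x) y = dual_form x (dual_projection i y)"
    if i: "i \<in> {1..n}" and "x \<in> dual_space" "y \<in> dual_space" for i x y
  proof -
    have "dual_form x (dual_projection i y) = dual_form (dual_projection i y) x"
      by (simp add: dual_form_def B_commute)
    then show ?thesis
      using that assms by (simp add: dual_form_projection B_commute)
  qed
  show "(\<Sum>i=1..n. dual_projection i x) = (\<alpha> / (\<alpha> - 1)) *\<^sub>R x" if x: "x \<in> dual_space" for x
  proof -
    have "(\<Sum>i=1..n. \<Sum>j=1..n. inject j (P j (coord i x))) =
        (\<Sum>j=1..n. inject j (P j (\<Sum>i=1..n. coord i x)))"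
      by (subst sum.swap) (simp add: linear_sum[OF linear_P] linear_sum[OF linear_inject])
    also have "\<dots> = 0"
      using x by (simp add: dual_space_def linear_0[OF linear_P] linear_0[OF linear_inject])
    finally have "(\<Sum>i=1..n. dual_inclusion i (coord i x)) = (\<Sum>i=1..n. inject i (coord i x))"
      by (simp add: dual_inclusion_def sum_subtractf scaleR_sum_right[symmetric])
    also have "\<dots> = x"
      using x by (simp add: dual_space_def)
    finally show ?thesis
      by (simp add: dual_projection_def scaleR_sum_right[symmetric])
  qed
qed

text \<open>
  If \<open>U\<close> spans an invariant subspace of the dual system, then the entries of the elements of \<open>U\<close> span
  an invariant subspace of \<open>X\<close>: up to scalars, \<open>P\<^sub>j x\<^sub>i\<close> is entry \<open>j\<close> of the \<open>i\<close>-th dual projection of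
  \<open>x\<close>, corrected by \<open>x\<^sub>i\<close> if \<open>j = i\<close>.  To catch a given \<open>x \<in> X\<close>, which is \<open>(1/\<alpha>) \<Sum>P\<^sub>i x\<close>, it
  suffices that \<open>U\<close> spans the images of the \<open>P\<^sub>i x\<close> in the dual space.
\<close>
lemma locally_finite_dual:
  assumes nz: "\<alpha> \<noteq> 0" "\<alpha> \<noteq> 1"
    and dual: "locally_finite n dual_space dual_projection"
  shows "locally_finite n X P"
  unfolding locally_finite_def
proof
  fix x assume x: "x \<in> X"
  have "\<exists>F. finite F \<and> F \<subseteq> dual_space \<and> dual_inclusion i (P i x) \<in> span F \<and>
      (\<forall>j\<in>{1..n}. \<forall>y\<in>F. dual_projection j y \<in> span F)" if i: "i \<in> {1..n}" for i
    using dual dual_inclusion_in_dual_space[OF nz(1) i P_closed[OF i x] P_idem[OF i x]]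
    unfolding locally_finite_def by blast
  then obtain F where F: "\<And>i. i \<in> {1..n} \<Longrightarrow> finite (F i) \<and> F i \<subseteq> dual_space \<and>
      dual_inclusion i (P i x) \<in> span (F i) \<and> (\<forall>j\<in>{1..n}. \<forall>y\<in>F i. dual_projection j y \<in> span (F i))"
    by metis
  define U where "U = (\<Union>i\<in>{1..n}. F i)"
  define G where "G = (\<Union>i\<in>{1..n}. coord i ` U)"
  have F_U: "span (F i) \<subseteq> span U" if "i \<in> {1..n}" for i
    using that by (intro span_mono) (auto simp: U_def)
  have U_dual: "U \<subseteq> dual_space"
    using F unfolding U_def by blast
  have U_inv: "dual_projection j y \<in> span U" if "j \<in> {1..n}" "y \<in> U" for j y
    using that F F_U unfolding U_def by blast
  have coord_G: "coord i z \<in> span G" if "i \<in> {1..n}" "z \<in> span U" for i z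
  proof -
    have "coord i z \<in> span (coord i ` U)"
      using that by (simp add: span_linear_image[OF linear_coord])
    also have "\<dots> \<subseteq> span G"
      using that by (intro span_mono) (auto simp: G_def)
    finally show ?thesis .
  qed
  have "finite G"
    using F by (auto simp: G_def U_def)
  moreover have "G \<subseteq> X"
    using U_dual by (auto simp: G_def dual_space_def)
  moreover have "x \<in> span G"
  proof -
    have "P i x \<in> span G" if i: "i \<in> {1..n}" for i
    proof -
      have "coord i (dual_inclusion i (P i x)) \<in> span G"
        using coord_G[OF i] F[OF i] F_U[OF i] by blast
      moreover have "coord i (dual_inclusion i (P i x)) = (1 - 1 / \<alpha>) *\<^sub>R P i x"
        using P_idem[OF i x] by (simp add: coord_dual_inclusion[OF i] scaleR_left_diff_distrib)
      ultimately show ?thesis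
        using span_scale[of "(1 - 1 / \<alpha>) *\<^sub>R P i x" G "\<alpha> / (\<alpha> - 1)"] nz
        by (simp add: field_simps)
    qed
    then have "(1 / \<alpha>) *\<^sub>R (\<Sum>i=1..n. P i x) \<in> span G"
      by (intro span_scale span_sum) auto
    then show ?thesis
      using nz P_sum[OF x] by simp
  qed
  moreover have "P j y \<in> span G" if j: "j \<in> {1..n}" and y: "y \<in> G" for j y
  proof -
    obtain i u where i: "i \<in> {1..n}" and u: "u \<in> U" and yu: "y = coord i u"
      using y by (auto simp: G_def)
    let ?d = "if j = i then y else 0"
    have "coord j (dual_projection i u) \<in> span G"
      using coord_G j i u U_inv by blast
    moreover have "coord j (dual_projection i u) = (\<alpha> / (\<alpha> - 1)) *\<^sub>R (?d - (1 / \<alpha>) *\<^sub>R P j y)"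
      by (simp add: dual_projection_def linear_scale[OF linear_coord] coord_dual_inclusion[OF j] yu)
    ultimately have w: "(\<alpha> / (\<alpha> - 1)) *\<^sub>R (?d - (1 / \<alpha>) *\<^sub>R P j y) \<in> span G"
      by simp
    have "\<alpha> *\<^sub>R ?d - (\<alpha> - 1) *\<^sub>R ((\<alpha> / (\<alpha> - 1)) *\<^sub>R (?d - (1 / \<alpha>) *\<^sub>R P j y)) \<in> span G"
      using y by (intro span_diff span_scale[OF w] span_scale[of ?d])
        (auto simp: span_base span_zero)
    \<comment> \<open>Solve the formula for the coordinate of the dual projection for \<open>P j y\<close>.\<close>
    moreover have "\<alpha> *\<^sub>R ?d - (\<alpha> - 1) *\<^sub>R ((\<alpha> / (\<alpha> - 1)) *\<^sub>R (?d - (1 / \<alpha>) *\<^sub>R P j y)) = P j y"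
      using nz by (simp add: scaleR_right_diff_distrib del: if_split)
    ultimately show ?thesis
      by simp
  qed
  ultimately show "\<exists>F. finite F \<and> F \<subseteq> X \<and> x \<in> span F \<and> (\<forall>i\<in>{1..n}. \<forall>y\<in>F. P i y \<in> span F)"
    by blast
qed

end

text \<open>
  The parameters that force local finiteness.  The type argument fixes the type of the underlying
  spaces, which is the same for all parameters, as induction over parameters requires.
\<close>
definition finite_parameter :: "'a::real_vector itself \<Rightarrow> nat \<Rightarrow> real \<Rightarrow> bool" where
  "finite_parameter T n \<alpha> \<longleftrightarrow> (\<forall>X B (P :: nat \<Rightarrow> (nat list \<Rightarrow> 'a) \<Rightarrow> (nat list \<Rightarrow> 'a)).
     projection_system n \<alpha> X B P \<longrightarrow> locally_finite n X P)"

lemma finite_parameter_complement: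
  assumes "finite_parameter T n \<alpha>"
  shows "finite_parameter T n (real n - \<alpha>)"
  unfolding finite_parameter_def
proof (intro allI impI)
  fix X B and P :: "nat \<Rightarrow> (nat list \<Rightarrow> 'a) \<Rightarrow> (nat list \<Rightarrow> 'a)"
  assume "projection_system n (real n - \<alpha>) X B P"
  then interpret projection_system n "real n - \<alpha>" X B P .
  have "locally_finite n X (\<lambda>i x. x - P i x)"
    using complement_system assms by (simp add: finite_parameter_def)
  then show "locally_finite n X P"
    by (rule locally_finite_complement)
qed

lemma finite_parameter_dual:
  assumes "finite_parameter T n (\<alpha> / (\<alpha> - 1))" "\<alpha> \<noteq> 0" "\<alpha> \<noteq> 1"
  shows "finite_parameter T n \<alpha>"
  unfolding finite_parameter_def
proof (intro allI impI)
  fix X B and P :: "nat \<Rightarrow> (nat list \<Rightarrow> 'a) \<Rightarrow> (nat list \<Rightarrow> 'a)"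
  assume "projection_system n \<alpha> X B P"
  then interpret list_projection_system n \<alpha> X B P
    by (simp add: list_projection_system_def)
  show "locally_finite n X P"
    using assms dual_system
    by (intro locally_finite_dual) (auto simp: finite_parameter_def list_projection_system_def)
qed

text \<open>
  For \<open>d = n - 1 - x\<close> one has \<open>(1 + 1/d) / (1/d) = d + 1 = n - x\<close>, so dualising and then
  complementing takes the successor of \<open>x\<close> back to \<open>x\<close>.  The bounds \<open>0\<close> and \<open>2\<close> are part of the induction
  since for \<open>n \<ge> 4\<close> they give \<open>d > 1\<close>; this keeps the successor below \<open>2\<close> and away from the excluded
  parameters \<open>0\<close> and \<open>1\<close>.
\<close>
lemma finite_parameter_orbit:
  assumes "n \<ge> 4" and \<alpha>: "0 \<le> \<alpha>" "\<alpha> < 2" and fin: "finite_parameter T n \<alpha>"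
  shows "0 \<le> (spectrum_map n ^^ k) \<alpha> \<and> (spectrum_map n ^^ k) \<alpha> < 2 \<and>
    finite_parameter T n ((spectrum_map n ^^ k) \<alpha>)"
proof (induction k)
  case 0
  then show ?case
    using assms by simp
next
  case (Suc k)
  define \<beta> where "\<beta> = (spectrum_map n ^^ k) \<alpha>"
  define d where "d = real n - 1 - \<beta>"
  have \<beta>: "0 \<le> \<beta>" "\<beta> < 2" "finite_parameter T n \<beta>"
    using Suc by (auto simp: \<beta>_def)
  have "d > 1"
    using assms \<beta> by (simp add: d_def)
  have next_eq: "(spectrum_map n ^^ Suc k) \<alpha> = 1 + 1 / d"
    by (simp add: spectrum_map_def \<beta>_def d_def)
  have "(1 + 1 / d) / (1 + 1 / d - 1) = real n - \<beta>"
  proof -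
    have "(1 + 1 / d) / (1 + 1 / d - 1) = d + 1"
      using \<open>d > 1\<close> by (simp add: field_simps)
    then show ?thesis
      by (simp add: d_def)
  qed
  then have "finite_parameter T n ((1 + 1 / d) / (1 + 1 / d - 1))"
    using finite_parameter_complement[OF \<beta>(3)] by simp
  moreover have d: "0 < 1 / d" "1 / d < 1"
    using \<open>d > 1\<close> by simp_all
  ultimately have "finite_parameter T n (1 + 1 / d)"
    using finite_parameter_dual[of T n "1 + 1 / d"] by force
  moreover have "0 \<le> 1 + 1 / d" "1 + 1 / d < 2"
    using d by linarith+
  ultimately show ?case
    unfolding next_eq by blast
qed

lemma finite_parameter_discrete_spectrum:
  assumes "n \<ge> 4" "\<alpha> \<in> discrete_spectrum n"
  shows "finite_parameter T n \<alpha>"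
proof -
  have "finite_parameter T n 0" "finite_parameter T n 1"
    by (auto simp: finite_parameter_def intro: projection_system.locally_finite_zero
        projection_system.locally_finite_one)
  then have "finite_parameter T n \<beta>" if "\<beta> \<in> Lambda0 n \<union> Lambda1 n" for \<beta>
    using that finite_parameter_orbit[OF assms(1), of 0 T] finite_parameter_orbit[OF assms(1), of 1 T]
    by (auto simp: Lambda0_def Lambda1_def)
  then show ?thesis
    using assms(2) finite_parameter_complement by (auto simp: discrete_spectrum_def)
qed

section \<open>Irreducible representations are finite-dimensional\<close>

interpretation complex_scaling: vector_space "scaleC :: complex \<Rightarrow> 'a::complex_hilbert_space \<Rightarrow> 'a"
proof
  show "1 *\<^sub>C x = x" for x :: 'a
    using scaleC_of_real[of 1 x] by simp
qed (simp_all add: scaleC_add_right scaleC_add_left scaleC_scaleC)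

lemma cinner_scaleC_right: "cinner x (c *\<^sub>C y) = cnj c * cinner x y"
  by (subst (1 2) cinner_commute) (simp add: cinner_scaleC_left)

lemma inner_scaleC_left: "inner (c *\<^sub>C x) y = inner x (cnj c *\<^sub>C y)"
  by (simp add: inner_eq_Re_cinner cinner_scaleC_left cinner_scaleC_right)

lemma scaleC_scaleR: "c *\<^sub>C (r *\<^sub>R x) = r *\<^sub>R (c *\<^sub>C x)"
  by (simp add: scaleC_of_real[symmetric] scaleC_scaleC mult.commute)

lemma linear_scaleC: "linear (scaleC c)"
  by (rule linearI) (simp_all add: scaleC_add_right scaleC_scaleR)

lemma norm_scaleC: "norm (c *\<^sub>C x) = cmod c * norm x"
proof -
  have "complex_of_real ((norm (c *\<^sub>C x))\<^sup>2) = (c * cnj c) * complex_of_real ((norm x)\<^sup>2)"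
    by (simp only: cinner_self[symmetric] cinner_scaleC_left cinner_scaleC_right mult.assoc
        mult.left_commute[of "cnj c"])
  also have "\<dots> = complex_of_real ((cmod c * norm x)\<^sup>2)"
    by (simp only: complex_norm_square[symmetric] of_real_mult power_mult_distrib)
  finally have "complex_of_real ((norm (c *\<^sub>C x))\<^sup>2) = complex_of_real ((cmod c * norm x)\<^sup>2)" .
  then have "(norm (c *\<^sub>C x))\<^sup>2 = (cmod c * norm x)\<^sup>2"
    by (simp only: of_real_eq_iff)
  then show ?thesis
    by (rule power2_eq_imp_eq) auto
qed

lemma bounded_linear_scaleC: "bounded_linear (scaleC c)"
  by (rule bounded_linear_intro[where K = "cmod c"])
    (auto simp: norm_scaleC scaleC_add_right scaleC_scaleR)

lemma orthogonal_projectionD: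
  assumes "orthogonal_projection P"
  shows "linear P" "P (c *\<^sub>C x) = c *\<^sub>C P x" "P (P x) = P x" "inner (P x) y = inner x (P y)"
  using assms
  by (auto simp: orthogonal_projection_def bounded_clinear_def inner_eq_Re_cinner
      intro: bounded_linear.linear)

lemma is_repD:
  assumes "is_rep n \<alpha> P"
  shows "i \<in> {1..n} \<Longrightarrow> orthogonal_projection (P i)" "(\<Sum>i=1..n. P i x) = \<alpha> *\<^sub>R x"
  using assms by (auto simp: is_rep_def scaleC_of_real)

text \<open>
  An orthonormal basis of the span, obtained by Gram-Schmidt.  Only this expansion property of \<open>E\<close> is
  used afterwards; it describes the span by a closed condition and computes traces.
\<close>
lemma finite_span_expansion:
  fixes F :: "'a::real_inner set"
  assumes "finite F"
  obtains E where "finite E" "\<And>x. x \<in> span F \<longleftrightarrow> (\<Sum>e\<in>E. inner x e *\<^sub>R e) = x"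
proof -
  obtain C where C: "finite C" "span C = span F" "pairwise orthogonal C"
    using basis_orthogonal[OF assms] by blast
  define E where "E = sgn ` (C - {0})"
  have EC: "E \<subseteq> span C"
    by (auto simp: E_def sgn_div_norm span_base intro!: span_scale)
  have orth: "inner e f = (if e = f then 1 else 0)" if ef: "e \<in> E" "f \<in> E" for e f
  proof -
    obtain c d where cd: "c \<in> C" "c \<noteq> 0" "e = sgn c" "d \<in> C" "d \<noteq> 0" "f = sgn d"
      using ef by (auto simp: E_def)
    show ?thesis
    proof (cases "c = d")
      case True
      then show ?thesis
        using cd by (simp add: norm_sgn dot_square_norm)
    next
      case False
      then have "inner c d = 0"
        using C(3) cd by (auto simp: pairwise_def orthogonal_def)
      then have "inner e f = 0"
        using cd by (simp add: sgn_div_norm)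
      moreover have "inner e e = 1"
        using cd by (simp add: norm_sgn dot_square_norm)
      ultimately show ?thesis
        by auto
    qed
  qed
  have fin: "finite E"
    using C by (simp add: E_def)
  let ?S = "{x. (\<Sum>e\<in>E. inner x e *\<^sub>R e) = x}"
  have sub: "subspace ?S"
    by (auto simp: subspace_def inner_add_left scaleR_add_left sum.distrib
        scaleR_sum_right[symmetric] scaleR_scaleR[symmetric] simp del: scaleR_scaleR)
  have "(\<Sum>f\<in>E. inner e f *\<^sub>R f) = e" if "e \<in> E" for e
  proof -
    have "(\<Sum>f\<in>E. inner e f *\<^sub>R f) = (\<Sum>f\<in>E. if e = f then f else 0)"
      using that by (intro sum.cong) (auto simp: orth)
    then show ?thesis
      using that fin by simp
  qed
  then have ES: "E \<subseteq> ?S"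
    by auto
  have "C \<subseteq> ?S"
  proof
    fix c assume c: "c \<in> C"
    show "c \<in> ?S"
    proof (cases "c = 0")
      case False
      then have "norm c *\<^sub>R sgn c \<in> ?S"
        using c ES by (intro subspace_scale[OF sub]) (auto simp: E_def)
      then show ?thesis
        using False by (simp add: sgn_div_norm)
    qed simp
  qed
  then have "span C \<subseteq> ?S"
    using sub by (rule span_minimal)
  moreover have "x \<in> span C" if "x \<in> ?S" for x
  proof -
    have "(\<Sum>e\<in>E. inner x e *\<^sub>R e) \<in> span C"
      using EC by (intro span_sum span_scale) auto
    then show ?thesis
      using that by simp
  qed
  ultimately show thesis
    using that fin C(2) by blast
qed

lemma finite_frame:
  fixes F :: "'a::real_inner set"
  assumes "finite F" "span F = UNIV"
  obtains E :: "'a set" where "finite E" "\<And>x. (\<Sum>e\<in>E. inner x e *\<^sub>R e) = x"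
proof -
  obtain E where "finite E" and E: "\<And>x. x \<in> span F \<longleftrightarrow> (\<Sum>e\<in>E. inner x e *\<^sub>R e) = x"
    using finite_span_expansion[OF assms(1)] by blast
  moreover have "(\<Sum>e\<in>E. inner x e *\<^sub>R e) = x" for x
    using E[of x] assms(2) by blast
  ultimately show thesis
    using that by blast
qed

lemma closed_finite_span:
  fixes F :: "'a::real_inner set"
  assumes "finite F"
  shows "closed (span F)"
proof -
  obtain E where "finite E" "\<And>x. x \<in> span F \<longleftrightarrow> (\<Sum>e\<in>E. inner x e *\<^sub>R e) = x"
    using finite_span_expansion[OF assms] by blast
  then have "span F = {x. (\<Sum>e\<in>E. inner x e *\<^sub>R e) = x}"
    by auto
  then show ?thesis
    by (auto intro!: closed_Collect_eq continuous_intros)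
qed

text \<open>
  Local finiteness puts a nonzero vector \<open>x\<close> into a finite-dimensional invariant real subspace.
  Adding its multiple by \<open>\<i>\<close> makes it a complex one; being closed and nonzero, it is the
  whole space by irreducibility.
\<close>
lemma irreducible_rep_finite_span:
  fixes P :: "nat \<Rightarrow> 'a::complex_hilbert_space \<Rightarrow> 'a"
  assumes n: "n \<ge> 4" "\<alpha> \<in> discrete_spectrum n" and rep: "is_rep n \<alpha> P" and irr: "irreducible_rep n P"
  obtains F :: "'a set" where "finite F" "span F = UNIV"
proof -
  note proj = orthogonal_projectionD[OF is_repD(1)[OF rep]]
  obtain x :: 'a where x: "x \<noteq> 0"
    using ex_nonzero by blast
  \<comment> \<open>The Hilbert space itself is represented by the functions supported at the empty list.\<close>
  define emb :: "'a \<Rightarrow> nat list \<Rightarrow> 'a" where "emb v = (\<lambda>l. if l = [] then v else 0)" for v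
  define ev :: "(nat list \<Rightarrow> 'a) \<Rightarrow> 'a" where "ev f = f []" for f
  have lin_emb: "linear emb" and lin_ev: "linear ev" and ev_emb: "ev (emb v) = v" for v
    by (auto intro!: linearI simp: emb_def ev_def fun_eq_iff)
  let ?Q = "\<lambda>i f. emb (P i (ev f))"
  have linQ: "linear (?Q i)" if "i \<in> {1..n}" for i
    using linear_compose[OF linear_compose[OF lin_ev proj(1)[OF that]] lin_emb] by (simp add: o_def)
  have "projection_system n \<alpha> (range emb) (\<lambda>f g. inner (ev f) (ev g)) ?Q"
  proof (rule projection_system.intro)
    show "subspace (range emb)"
      by (intro linear_subspace_image lin_emb) simp
    show "bilinear (\<lambda>f g. inner (ev f) (ev g))"
      by (auto simp: bilinear_def inner_add_left inner_add_right linear_add[OF lin_ev]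
          linear_scale[OF lin_ev] intro!: linearI)
    show "(\<Sum>i=1..n. ?Q i f) = \<alpha> *\<^sub>R f" if "f \<in> range emb" for f
      using that is_repD(2)[OF rep]
      by (auto simp: ev_emb linear_sum[OF lin_emb, symmetric] linear_scale[OF lin_emb, symmetric])
    show "inner (ev (?Q i f)) (ev g) = inner (ev f) (ev (?Q i g))" if "i \<in> {1..n}" for i f g
      using proj(4)[OF that] by (simp add: ev_emb)
  qed (use linQ in \<open>auto simp: ev_emb proj(3) inner_commute linear_0[OF lin_emb]\<close>)
  then have "locally_finite n (range emb) ?Q"
    using finite_parameter_discrete_spectrum[OF n, of "TYPE('a)"]
    by (simp add: finite_parameter_def)
  then have "\<exists>F. finite F \<and> F \<subseteq> range emb \<and> emb x \<in> span F \<and> (\<forall>i\<in>{1..n}. \<forall>f\<in>F. ?Q i f \<in> span F)"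
    unfolding locally_finite_def by (rule bspec) simp
  then obtain F where "finite F" and xF: "emb x \<in> span F"
    and QF: "\<forall>i\<in>{1..n}. \<forall>f\<in>F. ?Q i f \<in> span F"
    by (elim exE conjE)
  have ev_span: "ev f \<in> span (ev ` F)" if "f \<in> span F" for f
    using that by (simp add: span_linear_image[OF lin_ev])
  define G where "G = ev ` F \<union> scaleC \<i> ` ev ` F"
  let ?K = "span G"
  have FG: "span (ev ` F) \<subseteq> ?K"
    by (intro span_mono) (auto simp: G_def)
  have xK: "x \<in> ?K"
    using ev_span[OF xF] FG by (auto simp: ev_emb)
  have image_K: "L ` ?K \<subseteq> ?K" if "linear L" "\<And>y. y \<in> G \<Longrightarrow> L y \<in> ?K" for L
  proof -
    have "span (L ` G) \<subseteq> ?K"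
      using that by (intro span_minimal) (auto simp: subspace_span)
    then show ?thesis
      by (simp add: span_linear_image[OF that(1)])
  qed
  have iK: "scaleC \<i> ` ?K \<subseteq> ?K"
  proof (rule image_K[OF linear_scaleC])
    fix y assume "y \<in> G"
    then consider "y \<in> ev ` F" | z where "z \<in> ev ` F" "y = \<i> *\<^sub>C z"
      by (auto simp: G_def)
    then show "\<i> *\<^sub>C y \<in> ?K"
    proof cases
      case 1
      then show ?thesis by (auto intro: span_base simp: G_def)
    next
      case 2
      then have "\<i> *\<^sub>C y = - z"
        by (simp add: scaleC_scaleC complex_scaling.scale_minus_left)
      moreover have "z \<in> ?K"
        using 2 by (auto intro: span_base simp: G_def)
      ultimately show ?thesis
        by (simp add: span_neg)
    qed
  qed
  have cK: "c *\<^sub>C y \<in> ?K" if "y \<in> ?K" for c y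
  proof -
    have "c *\<^sub>C y = (complex_of_real (Re c) + complex_of_real (Im c) * \<i>) *\<^sub>C y"
      by (simp add: complex_eq_iff)
    also have "\<dots> = Re c *\<^sub>R y + Im c *\<^sub>R (\<i> *\<^sub>C y)"
      by (simp only: scaleC_add_left scaleC_scaleC[symmetric] scaleC_of_real)
    also have "\<dots> \<in> ?K"
      using that iK by (intro span_add span_scale) auto
    finally show ?thesis .
  qed
  have PK: "P i ` ?K \<subseteq> ?K" if i: "i \<in> {1..n}" for i
  proof (rule image_K[OF proj(1)[OF i]])
    fix y assume "y \<in> G"
    then consider "y \<in> ev ` F" | z where "z \<in> ev ` F" "y = \<i> *\<^sub>C z"
      by (auto simp: G_def)
    moreover have PF: "P i z \<in> ?K" if "z \<in> ev ` F" for z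
      proof -
      obtain f where "f \<in> F" "z = ev f"
        using \<open>z \<in> ev ` F\<close> by blast
      then have "ev (?Q i f) \<in> ?K"
        using QF i ev_span FG by blast
      then show ?thesis
        using \<open>z = ev f\<close> by (simp add: ev_emb)
    qed
    ultimately show "P i y \<in> ?K"
      by cases (auto simp: proj(2)[OF i] cK)
  qed
  have "finite G"
    using \<open>finite F\<close> by (simp add: G_def)
  then have "closed_csubspace ?K"
    using cK by (auto simp: closed_csubspace_def closed_finite_span span_zero span_add)
  then have "?K = UNIV"
    using irr PK x xK unfolding irreducible_rep_def by blast
  then show thesis
    using that \<open>finite G\<close> by blast
qed

section \<open>Morphisms of systems\<close>

text \<open>The trace identity \<open>tr (P A\<^sup>* A P) = tr (A\<^sup>* A P)\<close>.\<close>
lemma sum_projection_frame: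
  fixes A :: "'a::real_inner \<Rightarrow> 'b::real_inner"
  assumes E: "\<And>x. (\<Sum>e\<in>E. inner x e *\<^sub>R e) = x"
    and A: "linear A" and P: "linear P" "\<And>x. P (P x) = P x" "\<And>x y. inner (P x) y = inner x (P y)"
  shows "(\<Sum>e\<in>E. inner (A (P e)) (A (P e))) = (\<Sum>e\<in>E. inner (A e) (A (P e)))"
proof -
  have "(\<Sum>e\<in>E. inner (A (P e)) (A (P e))) = (\<Sum>e\<in>E. inner (A (\<Sum>f\<in>E. inner (P e) f *\<^sub>R f)) (A (P e)))"
    by (simp add: E)
  also have "\<dots> = (\<Sum>e\<in>E. \<Sum>f\<in>E. inner (P e) f * inner (A f) (A (P e)))"
    by (simp only: linear_sum[OF A] linear_scale[OF A] inner_sum_left inner_scaleR_left)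
  also have "\<dots> = (\<Sum>e\<in>E. \<Sum>f\<in>E. inner (P f) e * inner (A f) (A (P e)))"
  proof -
    have "inner (P e) f = inner (P f) e" for e f
      using P(3)[of e f] by (simp only: inner_commute)
    then show ?thesis
      by (intro sum.cong refl) metis
  qed
  also have "\<dots> = (\<Sum>e\<in>E. \<Sum>f\<in>E. inner (A f) (A (P (inner (P f) e *\<^sub>R e))))"
    by (simp only: linear_scale[OF A] linear_scale[OF P(1)] inner_scaleR_right)
  also have "\<dots> = (\<Sum>f\<in>E. inner (A f) (A (P (\<Sum>e\<in>E. inner (P f) e *\<^sub>R e))))"
    by (subst sum.swap) (simp only: linear_sum[OF A] linear_sum[OF P(1)] inner_sum_right)
  finally show ?thesis
    by (simp add: E P(2))
qed

context
  fixes n :: nat and \<alpha> \<alpha>' :: real and P :: "nat \<Rightarrow> 'a::complex_hilbert_space \<Rightarrow> 'a"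
    and P' :: "nat \<Rightarrow> 'b::complex_hilbert_space \<Rightarrow> 'b" and E :: "'a set" and R :: "'a \<Rightarrow> 'b"
  assumes rep: "is_rep n \<alpha> P" and rep': "is_rep n \<alpha>' P'"
    and E: "finite E" "\<And>x. (\<Sum>e\<in>E. inner x e *\<^sub>R e) = x"
    and R: "linear R" and morphism: "\<And>i. i \<in> {1..n} \<Longrightarrow> R ` rep_system P i \<subseteq> rep_system P' i"
begin

lemma projection_fixes_image:
  assumes i: "i \<in> {1..n}"
  shows "P' i (R (P i x)) = R (P i x)"
proof -
  have "R (P i x) \<in> range (P' i)"
    using morphism[OF i] by (auto simp: rep_system_def)
  then show ?thesis
    using orthogonal_projectionD(3)[OF is_repD(1)[OF rep' i]] by auto
qed

text \<open>
  Both sides are squared Hilbert-Schmidt norms.  For each \<open>i\<close>, Pythagoras and the trace identity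
  split the defect into \<open>\<parallel>P'\<^sub>iR\<parallel>\<^sup>2 - \<parallel>P'\<^sub>iRP\<^sub>i\<parallel>\<^sup>2\<close>, where \<open>P'\<^sub>iRP\<^sub>i = RP\<^sub>i\<close>.  Summing over \<open>i\<close>, the first terms give
  \<open>\<alpha>' \<parallel>R\<parallel>\<^sup>2\<close> and the second ones \<open>\<alpha> \<parallel>R\<parallel>\<^sup>2\<close>.
\<close>
lemma morphism_defect:
  "(\<Sum>i=1..n. \<Sum>e\<in>E. (norm (P' i (R (e - P i e))))\<^sup>2) = (\<alpha>' - \<alpha>) * (\<Sum>e\<in>E. (norm (R e))\<^sup>2)"
proof -
  note proj = orthogonal_projectionD[OF is_repD(1)[OF rep]]
  note proj' = orthogonal_projectionD[OF is_repD(1)[OF rep']]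
  have "(\<Sum>e\<in>E. (norm (P' i (R (e - P i e))))\<^sup>2) =
      (\<Sum>e\<in>E. inner (P' i (R e)) (R e)) - (\<Sum>e\<in>E. inner (R e) (R (P i e)))" if i: "i \<in> {1..n}" for i
  proof -
    let ?A = "\<lambda>x. P' i (R x)"
    have A: "linear ?A"
      using linear_compose[OF R proj'(1)[OF i]] by (simp add: o_def)
    have RP: "?A (P i x) = R (P i x)" for x
      by (rule projection_fixes_image[OF i])
    note tr = sum_projection_frame[OF E(2) _ proj(1)[OF i] proj(3)[OF i] proj(4)[OF i]]
    have "(\<Sum>e\<in>E. (norm (?A (e - P i e)))\<^sup>2) = (\<Sum>e\<in>E. inner (?A e) (?A e))
        - 2 * (\<Sum>e\<in>E. inner (?A e) (?A (P i e))) + (\<Sum>e\<in>E. inner (?A (P i e)) (?A (P i e)))"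
      by (simp add: power2_norm_eq_inner linear_diff[OF A] inner_diff_left inner_diff_right
          inner_commute sum.distrib sum_subtractf sum_distrib_left)
    also have "\<dots> = (\<Sum>e\<in>E. inner (?A e) (?A e)) - (\<Sum>e\<in>E. inner (?A (P i e)) (?A (P i e)))"
      using tr[OF A] by simp
    also have "(\<Sum>e\<in>E. inner (?A (P i e)) (?A (P i e))) = (\<Sum>e\<in>E. inner (R e) (R (P i e)))"
      using tr[OF R] by (simp add: RP)
    also have "(\<Sum>e\<in>E. inner (?A e) (?A e)) = (\<Sum>e\<in>E. inner (?A e) (R e))"
      by (intro sum.cong refl) (metis proj'(3)[OF i] proj'(4)[OF i])
    finally show ?thesis .
  qed
  then have "(\<Sum>i=1..n. \<Sum>e\<in>E. (norm (P' i (R (e - P i e))))\<^sup>2) =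
      (\<Sum>i=1..n. \<Sum>e\<in>E. inner (P' i (R e)) (R e)) - (\<Sum>i=1..n. \<Sum>e\<in>E. inner (R e) (R (P i e)))"
    by (simp add: sum_subtractf)
  also have "(\<Sum>i=1..n. \<Sum>e\<in>E. inner (P' i (R e)) (R e)) = (\<Sum>e\<in>E. inner (\<Sum>i=1..n. P' i (R e)) (R e))"
    by (subst sum.swap) (simp only: inner_sum_left)
  also have "(\<Sum>i=1..n. \<Sum>e\<in>E. inner (R e) (R (P i e))) = (\<Sum>e\<in>E. inner (R e) (R (\<Sum>i=1..n. P i e)))"
    by (subst sum.swap) (simp only: inner_sum_right linear_sum[OF R])
  finally show ?thesis
    unfolding is_repD(2)[OF rep] is_repD(2)[OF rep']
    by (simp add: linear_scale[OF R] sum_distrib_left[symmetric] left_diff_distrib power2_norm_eq_inner)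
qed

lemma eq_if_eq_on_frame:
  fixes S T :: "'a \<Rightarrow> 'c::real_vector"
  assumes "linear S" "linear T" "\<And>e. e \<in> E \<Longrightarrow> S e = T e"
  shows "S x = T x"
proof -
  have "S (\<Sum>e\<in>E. inner x e *\<^sub>R e) = T (\<Sum>e\<in>E. inner x e *\<^sub>R e)"
    using assms(3) by (simp add: linear_sum[OF assms(1)] linear_scale[OF assms(1)]
        linear_sum[OF assms(2)] linear_scale[OF assms(2)])
  then show ?thesis
    by (simp add: E)
qed

lemma morphism_parameter_le:
  assumes "R \<noteq> (\<lambda>x. 0)"
  shows "\<alpha> \<le> \<alpha>'"
proof -
  have "0 \<le> (\<alpha>' - \<alpha>) * (\<Sum>e\<in>E. (norm (R e))\<^sup>2)"
    unfolding morphism_defect[symmetric] by (intro sum_nonneg) auto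
  moreover have "(\<Sum>e\<in>E. (norm (R e))\<^sup>2) > 0"
  proof (rule ccontr)
    assume "\<not> ?thesis"
    moreover have "(\<Sum>e\<in>E. (norm (R e))\<^sup>2) \<ge> 0"
      by (intro sum_nonneg) auto
    ultimately have "(\<Sum>e\<in>E. (norm (R e))\<^sup>2) = 0"
      by linarith
    then have "R e = 0" if "e \<in> E" for e
      using that by (subst (asm) sum_nonneg_eq_0_iff) (auto simp: E)
    then have "R x = 0" for x
      using eq_if_eq_on_frame[OF R linear_zero] by simp
    then show False
      using assms by blast
  qed
  ultimately show ?thesis
    by (simp add: zero_le_mult_iff)
qed

lemma morphism_intertwines:
  assumes "\<alpha> = \<alpha>'" and i: "i \<in> {1..n}"
  shows "R (P i x) = P' i (R x)"
proof -
  note proj = orthogonal_projectionD[OF is_repD(1)[OF rep i]]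
  note proj' = orthogonal_projectionD[OF is_repD(1)[OF rep' i]]
  have "(\<Sum>i=1..n. \<Sum>e\<in>E. (norm (P' i (R (e - P i e))))\<^sup>2) = 0"
    using morphism_defect assms(1) by simp
  then have "(\<Sum>e\<in>E. (norm (P' i (R (e - P i e))))\<^sup>2) = 0"
    using i by (subst (asm) sum_nonneg_eq_0_iff) (auto simp: sum_nonneg)
  then have "P' i (R (e - P i e)) = 0" if "e \<in> E" for e
    using that E(1) by (subst (asm) sum_nonneg_eq_0_iff) auto
  moreover have "P' i (R (P i x)) = R (P i x)" for x
    by (rule projection_fixes_image[OF i])
  ultimately have "R (P i e) = P' i (R e)" if "e \<in> E" for e
    using that by (simp add: linear_diff[OF R] linear_diff[OF proj'(1)])
  then show ?thesis
    using eq_if_eq_on_frame[of "\<lambda>x. R (P i x)" "\<lambda>x. P' i (R x)" x]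
      linear_compose[OF proj(1) R] linear_compose[OF R proj'(1)]
    by (simp add: o_def)
qed

end

section \<open>Schur's lemma\<close>

context
  fixes A :: "'a::complex_hilbert_space \<Rightarrow> 'a"
  assumes A_add: "A (x + y) = A x + A y" and A_scaleC: "A (c *\<^sub>C x) = c *\<^sub>C A x"
begin

lemma linear_A: "linear A"
  by (rule linearI) (simp_all add: A_add A_scaleC scaleC_of_real[symmetric])

lemma A_power_diff: "(A ^^ k) (x - c *\<^sub>C y) = (A ^^ k) x - c *\<^sub>C (A ^^ k) y"
  by (induction k) (simp_all add: linear_diff[OF linear_A] A_scaleC)

text \<open>
  Split off a linear factor \<open>X - c\<close> of \<open>p\<close>: either \<open>(A - c) x = 0\<close>, or \<open>(A - c) x\<close> is a nonzero vector
  annihilated by a polynomial of smaller degree.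
\<close>
lemma eigenvector_of_annihilator:
  assumes "p \<noteq> 0" "x \<noteq> 0" "(\<Sum>k\<le>degree p. coeff p k *\<^sub>C (A ^^ k) x) = 0"
  shows "\<exists>c y. y \<noteq> 0 \<and> A y = c *\<^sub>C y"
  using assms
proof (induction "degree p" arbitrary: p x)
  case 0
  then have "coeff p 0 *\<^sub>C x = 0" "coeff p 0 \<noteq> 0"
    by (auto simp: leading_coeff_0_iff[symmetric] simp del: leading_coeff_0_iff)
  then show ?case
    using 0 by (simp add: complex_scaling.scale_eq_0_iff)
next
  case (Suc d)
  obtain c where "poly p c = 0"
    using Suc.hyps(2) alg_closed_imp_poly_has_root[of p] by auto
  then obtain q where p: "p = [:- c, 1:] * q"
    by (auto simp: poly_eq_0_iff_dvd elim: dvdE)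
  have q: "q \<noteq> 0"
    using Suc.prems p by auto
  then have deg: "degree p = Suc (degree q)"
    unfolding p by (subst degree_mult_eq) auto
  have coeff_p: "coeff p k = (case k of 0 \<Rightarrow> 0 | Suc j \<Rightarrow> coeff q j) - c * coeff q k" for k
    by (cases k) (simp_all add: p)
  let ?y = "A x - c *\<^sub>C x"
  have "0 = (\<Sum>k\<le>Suc (degree q). (case k of 0 \<Rightarrow> 0 | Suc j \<Rightarrow> coeff q j) *\<^sub>C (A ^^ k) x)
      - (\<Sum>k\<le>Suc (degree q). (c * coeff q k) *\<^sub>C (A ^^ k) x)"
    using Suc.prems(3) unfolding deg
    by (simp add: coeff_p complex_scaling.scale_left_diff_distrib sum_subtractf del: sum.atMost_Suc)
  also have "\<dots> = (\<Sum>k\<le>degree q. coeff q k *\<^sub>C (A ^^ Suc k) x)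
      - (\<Sum>k\<le>degree q. (c * coeff q k) *\<^sub>C (A ^^ k) x)"
    by (subst sum.atMost_Suc_shift) (simp add: coeff_eq_0)
  also have "\<dots> = (\<Sum>k\<le>degree q. coeff q k *\<^sub>C (A ^^ k) ?y)"
    by (simp add: A_power_diff complex_scaling.scale_right_diff_distrib sum_subtractf scaleC_scaleC
        funpow_swap1 mult.commute)
  finally have y: "(\<Sum>k\<le>degree q. coeff q k *\<^sub>C (A ^^ k) ?y) = 0" ..
  show ?case
  proof (cases "?y = 0")
    case True
    then show ?thesis
      using Suc.prems(2) by auto
  next
    case False
    then show ?thesis
      using Suc.hyps(1)[of q ?y] deg Suc.hyps(2) q y by simp
  qed
qed

text \<open>
  In a space spanned by \<open>m\<close> vectors, \<open>x, A x, ..., (A ^^ m) x\<close> are linearly dependent, even over the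
  reals; the dependency is an annihilating polynomial.
\<close>
lemma eigenvector_exists:
  assumes "finite F" "span F = (UNIV :: 'a set)"
  shows "\<exists>c y. y \<noteq> 0 \<and> A y = c *\<^sub>C y"
proof -
  obtain x :: 'a where x: "x \<noteq> 0"
    using ex_nonzero by blast
  define m where "m = card F"
  define v where "v k = (A ^^ k) x" for k
  have "\<exists>r. (\<exists>k\<le>m. r k \<noteq> 0) \<and> (\<Sum>k\<le>m. r k *\<^sub>R v k) = 0"
  proof (cases "inj_on v {..m}")
    case True
    have "dependent (v ` {..m})"
      using independent_span_bound[OF assms(1), of "v ` {..m}"] assms(2) card_image[OF True]
      by (auto simp: m_def)
    then obtain u where u: "\<exists>w\<in>v ` {..m}. u w \<noteq> 0" "(\<Sum>w\<in>v ` {..m}. u w *\<^sub>R w) = 0"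
      by (auto simp: dependent_finite)
    have "(\<Sum>k\<le>m. u (v k) *\<^sub>R v k) = 0"
      using u(2) by (simp add: sum.reindex[OF True])
    then show ?thesis
      using u(1) by (intro exI[of _ "\<lambda>k. u (v k)"]) auto
  next
    case False
    \<comment> \<open>If two powers agree on \<open>x\<close>, the dependency is not visible in the set of values.\<close>
    then obtain i j where ij: "i \<le> m" "j \<le> m" "i \<noteq> j" "v i = v j"
      by (auto simp: inj_on_def)
    have "(\<Sum>k\<le>m. ((if k = i then 1 else 0) - (if k = j then 1 else 0)) *\<^sub>R v k) =
        (\<Sum>k\<le>m. if k = i then v k else 0) - (\<Sum>k\<le>m. if k = j then v k else 0)"
      unfolding sum_subtractf[symmetric] by (intro sum.cong) (auto simp: scaleR_left_diff_distrib)
    also have "\<dots> = 0"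
      using ij by simp
    finally show ?thesis
      using ij by (intro exI[of _ "\<lambda>k. (if k = i then 1 else 0) - (if k = j then 1 else 0)"]) auto
  qed
  then obtain r where r: "\<exists>k\<le>m. r k \<noteq> 0" "(\<Sum>k\<le>m. r k *\<^sub>R v k) = 0"
    by blast
  define p where "p = (\<Sum>k\<le>m. monom (complex_of_real (r k)) k)"
  have coeff_p: "coeff p k = (if k \<le> m then complex_of_real (r k) else 0)" for k
    by (simp add: p_def coeff_sum coeff_monom)
  have "p \<noteq> 0"
    using r(1) coeff_p by (metis coeff_0 of_real_eq_0_iff)
  have "degree p \<le> m"
    by (rule degree_le) (simp add: coeff_p)
  then have "(\<Sum>k\<le>degree p. coeff p k *\<^sub>C v k) = (\<Sum>k\<le>m. coeff p k *\<^sub>C v k)"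
    by (intro sum.mono_neutral_left) (auto simp: coeff_eq_0)
  also have "\<dots> = 0"
    using r(2) by (simp add: coeff_p scaleC_of_real)
  finally show ?thesis
    using eigenvector_of_annihilator[OF \<open>p \<noteq> 0\<close> x] by (simp add: v_def)
qed

end

text \<open>The eigenspace of any eigenvalue of \<open>A\<close> is closed, nonzero and invariant.\<close>
lemma schur:
  fixes P :: "nat \<Rightarrow> 'a::complex_hilbert_space \<Rightarrow> 'a"
  assumes irr: "irreducible_rep n P" and P: "\<And>i. i \<in> {1..n} \<Longrightarrow> orthogonal_projection (P i)"
    and F: "finite F" "span F = (UNIV :: 'a set)"
    and A: "bounded_clinear A" and comm: "\<And>i x. i \<in> {1..n} \<Longrightarrow> A (P i x) = P i (A x)"
  obtains c where "A = (\<lambda>x. c *\<^sub>C x)"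
proof -
  have bl: "bounded_linear A" and sc: "\<And>c x. A (c *\<^sub>C x) = c *\<^sub>C A x"
    using A by (auto simp: bounded_clinear_def)
  note add = linear_add[OF bounded_linear.linear[OF bl]]
  obtain c y where y: "y \<noteq> 0" "A y = c *\<^sub>C y"
    using eigenvector_exists[OF add sc F] by blast
  let ?V = "{x. A x = c *\<^sub>C x}"
  have "closed ?V"
    using bl bounded_linear_scaleC
    by (intro closed_Collect_eq) (auto intro: linear_continuous_on)
  then have "closed_csubspace ?V"
    by (auto simp: closed_csubspace_def add sc scaleC_add_right scaleC_scaleC mult.commute
        linear_0[OF bounded_linear.linear[OF bl]])
  moreover have "P i ` ?V \<subseteq> ?V" if "i \<in> {1..n}" for i
    using orthogonal_projectionD(2)[OF P[OF that]] comm[OF that] by auto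
  ultimately have "?V = {0} \<or> ?V = UNIV"
    using irr by (auto simp: irreducible_rep_def)
  then have "A x = c *\<^sub>C x" for x
    using y by auto
  then show thesis
    using that by blast
qed

text \<open>
  By Schur's lemma \<open>R\<^sup>*R\<close> is a scalar \<open>r\<close>, necessarily positive, and \<open>R\<close> divided by the square root of
  \<open>r\<close> is unitary.
\<close>
lemma intertwining_bijection_unitarily_equivalent:
  fixes P :: "nat \<Rightarrow> 'a::complex_hilbert_space \<Rightarrow> 'a" and P' :: "nat \<Rightarrow> 'b::complex_hilbert_space \<Rightarrow> 'b"
  assumes irr: "irreducible_rep n P" and P: "\<And>i. i \<in> {1..n} \<Longrightarrow> orthogonal_projection (P i)"
    and P': "\<And>i. i \<in> {1..n} \<Longrightarrow> orthogonal_projection (P' i)"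
    and F: "finite F" "span F = (UNIV :: 'a set)"
    and R: "bounded_clinear R" "bij R" and comm: "\<And>i x. i \<in> {1..n} \<Longrightarrow> R (P i x) = P' i (R x)"
  shows "unitarily_equivalent n P P'"
proof -
  have blR: "bounded_linear R" and scR: "\<And>c x. R (c *\<^sub>C x) = c *\<^sub>C R x"
    using R by (auto simp: bounded_clinear_def)
  note linR = bounded_linear.linear[OF blR]
  obtain E where E: "finite E" "\<And>x::'a. (\<Sum>e\<in>E. inner x e *\<^sub>R e) = x"
    by (rule finite_frame[OF F]) (erule that)
  \<comment> \<open>\<open>A\<close> is \<open>R\<^sup>*R\<close>, written out in the basis \<open>E\<close>.\<close>
  define A where "A x = (\<Sum>e\<in>E. inner (R x) (R e) *\<^sub>R e)" for x
  have A: "inner (A x) y = inner (R x) (R y)" for x y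
  proof -
    have "inner (R x) (R y) = inner (R x) (R (\<Sum>e\<in>E. inner y e *\<^sub>R e))"
      by (simp add: E)
    also have "\<dots> = inner (A x) y"
      by (simp add: A_def linear_sum[OF linR] linear_scale[OF linR] inner_sum_left inner_sum_right
          inner_commute mult.commute)
    finally show ?thesis ..
  qed
  have eqI: "u = w" if "\<And>y. inner u y = inner w y" for u w :: 'a
  proof -
    have "inner (u - w) (u - w) = 0"
      using that by (simp add: inner_diff_left)
    then show ?thesis
      by simp
  qed
  have "bounded_linear A"
    unfolding A_def
    by (intro bounded_linear_sum bounded_linear_scaleR_const bounded_linear_inner_left_comp blR)
  moreover have "A (c *\<^sub>C x) = c *\<^sub>C A x" for c x
    by (rule eqI) (simp add: A inner_scaleC_left scR)
  ultimately have "bounded_clinear A"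
    by (simp add: bounded_clinear_def)
  moreover have "A (P i x) = P i (A x)" if i: "i \<in> {1..n}" for i x
    by (rule eqI) (simp add: A comm[OF i] orthogonal_projectionD(4)[OF P[OF i]]
        orthogonal_projectionD(4)[OF P'[OF i]])
  ultimately obtain c where c: "A = (\<lambda>x. c *\<^sub>C x)"
    using schur[OF irr P F] by blast
  have Re_eq: "Re (cinner (R x) (R y)) = Re (c * cinner x y)" for x y
    using A[of x y] by (simp add: c inner_eq_Re_cinner cinner_scaleC_left)
  have cin: "cinner (R x) (R y) = c * cinner x y" for x y
  proof -
    \<comment> \<open>Multiplying \<open>x\<close> by \<open>\<i>\<close> exchanges real and imaginary parts.\<close>
    have "Im (cinner (R x) (R y)) = Im (c * cinner x y)"
      using Re_eq[of "\<i> *\<^sub>C x" y] by (simp add: scR cinner_scaleC_left algebra_simps)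
    then show ?thesis
      using Re_eq[of x y] by (simp add: complex_eq_iff)
  qed
  obtain x :: 'a where x: "x \<noteq> 0"
    using ex_nonzero by blast
  define r where "r = (norm (R x))\<^sup>2 / (norm x)\<^sup>2"
  have "R x \<noteq> 0"
    using x R(2) linear_0[OF linR] by (metis bij_is_inj injD)
  then have r: "r > 0"
    using x by (simp add: r_def)
  have "c = complex_of_real r"
    using cin[of x x] x by (simp add: cinner_self r_def field_simps)
  note cin = cin[unfolded this]
  define s where "s = complex_of_real (1 / sqrt r)"
  have s: "s \<noteq> 0" "s * (cnj s * complex_of_real r) = 1"
  proof -
    show "s \<noteq> 0"
      using r by (simp add: s_def)
    have "1 / sqrt r * (1 / sqrt r * r) = 1"
      using r by (simp add: field_simps)
    then show "s * (cnj s * complex_of_real r) = 1"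
      unfolding s_def by (metis complex_cnj_complex_of_real of_real_1 of_real_mult)
  qed
  define W where "W = (\<lambda>x. s *\<^sub>C R x)"
  have "bounded_clinear W"
    using bounded_linear_compose[OF bounded_linear_scaleC blR]
    by (simp add: bounded_clinear_def W_def scR scaleC_scaleC mult.commute)
  moreover have "bij W"
  proof -
    have "bij (\<lambda>y :: 'b. s *\<^sub>C y)"
      using s(1) by (intro bij_betw_byWitness[where f' = "\<lambda>y. (1 / s) *\<^sub>C y"]) (auto simp: scaleC_scaleC)
    then show ?thesis
      using bij_comp[OF R(2)] by (simp add: W_def o_def)
  qed
  moreover have "cinner (W x) (W y) = cinner x y" for x y
  proof -
    have "cinner (W x) (W y) = s * (cnj s * complex_of_real r) * cinner x y"
      by (simp add: W_def cinner_scaleC_left cinner_scaleC_right cin)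
    then show ?thesis
      using s(2) by simp
  qed
  moreover have "W (P i x) = P' i (W x)" if i: "i \<in> {1..n}" for i x
    by (simp add: W_def comm[OF i] orthogonal_projectionD(2)[OF P'[OF i]])
  ultimately show ?thesis
    by (auto simp: unitarily_equivalent_def unitary_map_def)
qed

section \<open>Transitivity and isomorphism\<close>

lemma transitive_rep_system:
  fixes P :: "nat \<Rightarrow> 'a::complex_hilbert_space \<Rightarrow> 'a"
  assumes rep: "is_rep n \<alpha> P" and irr: "irreducible_rep n P"
    and F: "finite F" "span F = (UNIV :: 'a set)"
  shows "transitive_system n (rep_system P)"
proof -
  obtain E where E: "finite E" "\<And>x::'a. (\<Sum>e\<in>E. inner x e *\<^sub>R e) = x"
    by (rule finite_frame[OF F]) (erule that)
  have "\<exists>c. R = (\<lambda>x. c *\<^sub>C x)" if R: "R \<in> End_system n (rep_system P)" for R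
  proof -
    have "bounded_clinear R" and mor: "\<And>i. i \<in> {1..n} \<Longrightarrow> R ` rep_system P i \<subseteq> rep_system P i"
      using R by (auto simp: End_system_def)
    moreover have "linear R"
      using \<open>bounded_clinear R\<close> by (simp add: bounded_clinear_def bounded_linear.linear)
    ultimately show ?thesis
      using schur[OF irr is_repD(1)[OF rep] F] morphism_intertwines[OF rep rep E \<open>linear R\<close> mor refl]
      by metis
  qed
  moreover have "(\<lambda>x. c *\<^sub>C x) \<in> End_system n (rep_system P)" for c
    using orthogonal_projectionD(2)[OF is_repD(1)[OF rep]]
    by (auto simp: End_system_def bounded_clinear_def bounded_linear_scaleC scaleC_scaleC
        mult.commute rep_system_def simp flip: orthogonal_projectionD(2)[OF is_repD(1)[OF rep]])
  ultimately show ?thesis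
    by (auto simp: transitive_system_def)
qed

lemma isomorphic_imp_unitarily_equivalent:
  fixes P :: "nat \<Rightarrow> 'a::complex_hilbert_space \<Rightarrow> 'a" and P' :: "nat \<Rightarrow> 'b::complex_hilbert_space \<Rightarrow> 'b"
  assumes rep: "is_rep n \<alpha> P" and rep': "is_rep n \<alpha>' P'" and irr: "irreducible_rep n P"
    and F: "finite F" "span F = (UNIV :: 'a set)"
    and F': "finite F'" "span F' = (UNIV :: 'b set)"
    and iso: "isomorphic_systems n (rep_system P) (rep_system P')"
  shows "unitarily_equivalent n P P'"
proof -
  obtain E where E: "finite E" "\<And>x::'a. (\<Sum>e\<in>E. inner x e *\<^sub>R e) = x"
    by (rule finite_frame[OF F]) (erule that)
  obtain E' where E': "finite E'" "\<And>x::'b. (\<Sum>e\<in>E'. inner x e *\<^sub>R e) = x"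
    by (rule finite_frame[OF F']) (erule that)
  obtain R where R: "bounded_clinear R" "bij R"
    and mor: "\<And>i. i \<in> {1..n} \<Longrightarrow> R ` rep_system P i = rep_system P' i"
    using iso by (auto simp: isomorphic_systems_def)
  have lin: "linear R"
    using R(1) by (simp add: bounded_clinear_def bounded_linear.linear)
  let ?S = "inv R"
  have RS: "R (?S y) = y" and SR: "?S (R x) = x" for x y
    using R(2) by (simp_all add: bij_is_surj surj_f_inv_f bij_is_inj inv_f_f)
  have linS: "linear ?S"
  proof (rule linearI)
    show "?S (x + y) = ?S x + ?S y" for x y
      using SR[of "?S x + ?S y"] by (simp add: linear_add[OF lin] RS)
    show "?S (r *\<^sub>R x) = r *\<^sub>R ?S x" for r x
      using SR[of "r *\<^sub>R ?S x"] by (simp add: linear_scale[OF lin] RS)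
  qed
  have morS: "?S ` rep_system P' i \<subseteq> rep_system P i" if "i \<in> {1..n}" for i
    unfolding mor[OF that, symmetric] by (auto simp: SR)
  obtain x :: 'a where x: "x \<noteq> 0"
    using ex_nonzero by blast
  have "R \<noteq> (\<lambda>x. 0)"
    using x SR linear_0[OF linS] by metis
  then have "\<alpha> \<le> \<alpha>'"
    using morphism_parameter_le[OF rep rep' E lin] mor by blast
  moreover have "?S \<noteq> (\<lambda>x. 0)"
    using x SR by metis
  then have "\<alpha>' \<le> \<alpha>"
    using morphism_parameter_le[OF rep' rep E' linS] morS by blast
  ultimately have "\<alpha> = \<alpha>'"
    by simp
  have "R (P i x) = P' i (R x)" if "i \<in> {1..n}" for i x
    using morphism_intertwines[OF rep rep' E lin _ \<open>\<alpha> = \<alpha>'\<close> that] mor by blast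
  then show ?thesis
    using is_repD(1)[OF rep] is_repD(1)[OF rep']
    by (intro intertwining_bijection_unitarily_equivalent[OF irr _ _ F R]) auto
qed

theorem theorem3:
  fixes n :: nat
  assumes "n \<ge> 4"
  shows "(\<forall>\<alpha>\<in>discrete_spectrum n. \<forall>P :: nat \<Rightarrow> 'a::complex_hilbert_space \<Rightarrow> 'a.
            is_rep n \<alpha> P \<and> irreducible_rep n P \<longrightarrow> transitive_system n (rep_system P)) \<and>
         (\<forall>\<alpha>\<in>discrete_spectrum n. \<forall>\<alpha>'\<in>discrete_spectrum n.
            \<forall>(P :: nat \<Rightarrow> 'a \<Rightarrow> 'a) (P' :: nat \<Rightarrow> 'b::complex_hilbert_space \<Rightarrow> 'b).
              is_rep n \<alpha> P \<and> irreducible_rep n P \<and>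
              is_rep n \<alpha>' P' \<and> irreducible_rep n P' \<and>
              \<not> unitarily_equivalent n P P' \<longrightarrow>
              \<not> isomorphic_systems n (rep_system P) (rep_system P'))"
  by (meson assms irreducible_rep_finite_span transitive_rep_system isomorphic_imp_unitarily_equivalent)

end
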